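(* Let $p$ be a prime, $q=p^e>4$, and let $\ell$ be a positive integer with $2\ell\mid e$. Let $\boldsymbol a=(a_1,\ldots,a_n)$ be a vector of pairwise distinct elements of $\mathbb F_q$ and put $u_j=\prod_{1\le i\le n,\,i\ne j}(a_j-a_i)^{-1}$. Let $\delta\in\mathbb Z_{>0}$ and $\lambda\in\mathbb F_{p^\ell}^{*}$. Suppose that $\lambda a_j^{\delta-1}u_j\in\mathbb F_{p^\ell}^{*}$ for $1\le j\le n$. Assume that $\frac{n-\delta}{p^\ell+1}\in\mathbb Z_{>0}$ and put $k=\xi+1+\frac{n-\delta}{p^\ell+1}$. If $\xi$ and $s$ are integers with $0\le \xi\le\min\left\{p^\ell-1,\left\lfloor\frac{n-\delta}{p^\ell(p^\ell+1)}\right\rfloor\right\}$ and $\xi+1\le s\le\min\{\xi+p^\ell,k-1\}$, then there exists an $[n+s,k]_q$ generalized Roth-Lempel code $C$ with a $(k-s+1)$-dimensional $\ell$-Galois hull, i.e. $\dim(\operatorname{Hull}_\ell(C))=k-s+1$.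
   Context: For $q=p^e$ and $0\le\ell\le e-1$, the $\ell$-Galois inner product on $\mathbb F_q^N$ is $\langle\boldsymbol x,\boldsymbol y\rangle_\ell=\sum_i x_iy_i^{p^\ell}$. For a linear code $C\subseteq\mathbb F_q^N$, $C^{\perp_\ell}=\{\boldsymbol x\in\mathbb F_q^N:\langle\boldsymbol c,\boldsymbol x\rangle_\ell=0\ \text{for all }\boldsymbol c\in C\}$ and the $\ell$-Galois hull is $\operatorname{Hull}_\ell(C)=C\cap C^{\perp_\ell}$. Generalized Roth-Lempel (GRL) code: let $1\le s\le k\le n$, let $\boldsymbol a\in\mathbb F_q^n$ have pairwise distinct entries, let $\boldsymbol v\in(\mathbb F_q^* )^n$ and $A_s\in\operatorname{GL}_s(\mathbb F_q)$. Then $\operatorname{GRL}_k(\boldsymbol a,\boldsymbol v,A_s)$ is the $[n+s,k]_q$ linear code $$\{(v_1f(a_1),\ldots,v_nf(a_n),(f_{k-s},\ldots,f_{k-1})A_s): f(x)=\textstyle\sum_{j=0}^{k-1}f_jx^j\in\mathbb F_q[x]\}.$$ An $[N,k]_q$ code is a $k$-dimensional subspace of $\mathbb F_q^N$. Convention: $x^0=1$, including $0^0=1$. *)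

theory Defs
  imports
    "HOL-Computational_Algebra.Polynomial"
    "HOL-Algebra.Subrings"
    "Jordan_Normal_Form.VS_Connect"
begin

(* The field F_q is a finite field type 'a; F_q^N is carrier_vec N, so coordinates are
   indexed from 0 (the entry a_j of the mathematical notation is a $ (j - 1)). *)

definition code_dim :: "nat \<Rightarrow> 'a::field vec set \<Rightarrow> nat" where
  "code_dim N C = vectorspace.dim class_ring ((module_vec TYPE('a) N)\<lparr>carrier := C\<rparr>)"

definition linear_code :: "nat \<Rightarrow> nat \<Rightarrow> 'a::field vec set \<Rightarrow> bool" where
  "linear_code N k C \<longleftrightarrow>
     VectorSpace.subspace class_ring C (module_vec TYPE('a) N) \<and> code_dim N C = k"

definition galois_inner :: "nat \<Rightarrow> nat \<Rightarrow> 'a::field vec \<Rightarrow> 'a vec \<Rightarrow> 'a" where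
  "galois_inner p l x y = (\<Sum>i<dim_vec x. x $ i * (y $ i) ^ (p ^ l))"

definition galois_dual :: "nat \<Rightarrow> nat \<Rightarrow> nat \<Rightarrow> 'a::field vec set \<Rightarrow> 'a vec set" where
  "galois_dual p l N C = {x \<in> carrier_vec N. \<forall>c\<in>C. galois_inner p l c x = 0}"

definition galois_hull :: "nat \<Rightarrow> nat \<Rightarrow> nat \<Rightarrow> 'a::field vec set \<Rightarrow> 'a vec set" where
  "galois_hull p l N C = C \<inter> galois_dual p l N C"

(* Multiplying the row vector (f_{k-s}, ..., f_{k-1}) by A on the right is multiplying the
   transpose of A by the corresponding column vector.  For k > 0 the condition
   degree f < k also admits f = 0. *)
definition GRL :: "nat \<Rightarrow> 'a::field vec \<Rightarrow> 'a vec \<Rightarrow> 'a mat \<Rightarrow> 'a vec set" where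
  "GRL k a v A =
     {vec (dim_vec a) (\<lambda>i. v $ i * poly f (a $ i)) @\<^sub>v
      (transpose_mat A *\<^sub>v
         vec (dim_row A) (\<lambda>i. Polynomial.coeff f (k - dim_row A + i))) | f. degree f < k}"

definition is_GRL_code :: "nat \<Rightarrow> nat \<Rightarrow> nat \<Rightarrow> 'a::field vec set \<Rightarrow> bool" where
  "is_GRL_code n s k C \<longleftrightarrow>
     1 \<le> s \<and> s \<le> k \<and> k \<le> n \<and>
     (\<exists>a v A. a \<in> carrier_vec n \<and> inj_on (($) a) {..<n} \<and>
              v \<in> carrier_vec n \<and> (\<forall>i<n. v $ i \<noteq> 0) \<and>
              A \<in> carrier_mat s s \<and> invertible_mat A \<and>
              C = GRL k a v A)"

end

theory Submission
  imports Defs "HOL-Number_Theory.Residues"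
begin

text \<open>Write P for p ^ l and m for k - 1 - \<xi>. Since the norm from the field of order P ^ 2 onto
  the field of order P is surjective, v can be chosen with v_t ^ (P + 1) =
  \<lambda> a_t ^ (\<delta> - 1) u_t. By Lagrange interpolation, the contribution of the first n
  coordinates to the product of the codewords of x ^ i and x ^ j then vanishes for
  i + P j < m (P + 1) and equals \<lambda> for i + P j = m (P + 1). The matrix A is the identity except for
  the column belonging to x ^ m, which is chosen (using a (P + 1)-th root of -\<lambda>) to cancel
  column m of this Gram matrix. The polynomials in the hull are then exactly those without
  monomials x ^ j for k - s \<le> j < k, j \<noteq> m.\<close>

section \<open>Finite fields: cyclic multiplicative group and surjectivity of the norm\<close>

text \<open>Multiplication by \<open>x\<close> permutes the nonzero elements of \<open>K\<close>, so
  their product, which is nonzero, absorbs the factor \<open>x ^ (card K - 1)\<close>. A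
  multiplicatively closed set is used so that the result serves both the whole field and its
  subfield of order \<open>p ^ l\<close>.\<close>

lemma power_card_minus_one:
  fixes K :: "'a::field set"
  assumes fin: "finite K" and zero: "0 \<in> K"
    and mult: "\<And>y z. y \<in> K \<Longrightarrow> z \<in> K \<Longrightarrow> y * z \<in> K"
    and x: "x \<in> K - {0}"
  shows "x ^ (card K - 1) = 1"
proof -
  have inj: "inj_on ((*) x) (K - {0})" using x by (auto intro: inj_onI)
  have "(*) x ` (K - {0}) = K - {0}"
    using mult x by (intro endo_inj_surj[OF _ _ inj] finite_Diff fin) auto
  then have "(\<Prod>y\<in>K - {0}. y) = (\<Prod>y\<in>K - {0}. x * y)"
    using prod.reindex[OF inj, of id] by simp
  also have "\<dots> = x ^ card (K - {0}) * (\<Prod>y\<in>K - {0}. y)"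
    by (simp add: prod.distrib)
  finally have "x ^ card (K - {0}) = 1"
    using fin by simp
  then show ?thesis using zero by (simp add: card_Diff_singleton)
qed

text \<open>The characteristic is a prime dividing the order of the field. Identifying it with
  \<open>p\<close> allows the power \<open>p ^ l\<close> to be distributed over sums later
  on.\<close>

lemma CHAR_eq_of_card:
  assumes p: "prime p" and card: "card (UNIV :: 'a::{field,finite} set) = p ^ e"
  shows "CHAR('a) = p"
proof -
  have "prime CHAR('a)"
    using prime_CHAR_semidom[where ?'a = 'a] finite_imp_CHAR_pos[where ?'a = 'a] by auto
  moreover have "CHAR('a) dvd p ^ e"
    using CHAR_dvd_CARD[where ?'a = 'a] card by simp
  ultimately show ?thesis
    using p by (metis prime_dvd_power primes_dvd_imp_eq)
qed

text \<open>The multiplicative group is cyclic of order q - 1. For the last property: if q - 1 did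
  not divide \<open>i\<close>, its remainder \<open>d\<close> would be positive with
  \<open>g ^ d = 1\<close>, and fewer than q - 1 powers of \<open>g\<close> would have to exhaust
  the nonzero elements.\<close>

lemma finite_field_generator:
  obtains g :: "'a::{field,finite}" where "g \<noteq> 0" and "\<And>x. x \<noteq> 0 \<Longrightarrow> \<exists>i. x = g ^ i"
    and "\<And>i. g ^ i = 1 \<Longrightarrow> card (UNIV :: 'a set) - 1 dvd i"
proof -
  obtain g :: 'a where g: "g \<noteq> 0" "UNIV - {0} = {g ^ i | i :: nat. True}"
    using field.finite_field_mult_group_has_gen[OF class_field[where ?'a = 'a]]
    by (auto simp: class_ring_simps)
  have gen: "\<exists>i. x = g ^ i" if "x \<noteq> 0" for x using g(2) that by blast
  have "card (UNIV :: 'a set) - 1 dvd i" if i: "g ^ i = 1" for i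
  proof (rule ccontr)
    let ?N = "card (UNIV :: 'a set) - 1"
    assume ndvd: "\<not> ?N dvd i"
    define d where "d = i mod ?N"
    have N: "g ^ ?N = 1"
      using power_card_minus_one[of "UNIV :: 'a set" g] g(1) by simp
    have "card {0, 1 :: 'a} \<le> card (UNIV :: 'a set)" by (intro card_mono) auto
    then have pos: "?N > 0" by simp
    have "g ^ i = (g ^ ?N) ^ (i div ?N) * g ^ d"
      unfolding d_def power_mult[symmetric] power_add[symmetric] by simp
    then have gd: "g ^ d = 1" unfolding N i by simp
    have d: "0 < d" "d < ?N" "g ^ d = 1"
      using ndvd pos gd by (auto simp: d_def mod_greater_zero_iff_not_dvd)
    have "UNIV - {0} \<subseteq> (\<lambda>j. g ^ j) ` {..<d}"
    proof
      fix x :: 'a assume "x \<in> UNIV - {0}"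
      then obtain j where j: "x = g ^ j" using gen by auto
      have "g ^ j = (g ^ d) ^ (j div d) * g ^ (j mod d)"
        unfolding power_mult[symmetric] power_add[symmetric] by simp
      then have "x = g ^ (j mod d)" using j d by simp
      then show "x \<in> (\<lambda>j. g ^ j) ` {..<d}" using d by auto
    qed
    then have "card (UNIV - {0 :: 'a}) \<le> card ((\<lambda>j. g ^ j) ` {..<d})" by (intro card_mono) auto
    also have "\<dots> \<le> d" using card_image_le[of "{..<d}"] by simp
    finally show False using d by (simp add: card_Diff_singleton)
  qed
  with that[OF g(1) gen] show ?thesis by blast
qed

lemma nat_minus_one_dvd_power_minus_one: "(x :: nat) > 0 \<Longrightarrow> x - 1 dvd x ^ n - 1"
  using cong_pow[of x 1 "x - 1" n] by (intro cong_to_1_nat) (simp add: cong_altdef_nat)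

text \<open>Write \<open>x = g ^ i\<close> with a generator \<open>g\<close>. The order of
  \<open>g\<close> divides \<open>i * (P - 1)\<close>, and it is a multiple of (P + 1)(P - 1), so P
  + 1 divides \<open>i\<close>.\<close>

lemma norm_surjective:
  fixes x :: "'a::{field,finite}"
  assumes dvd: "P\<^sup>2 - 1 dvd card (UNIV :: 'a set) - 1" and P: "P > 1" and x: "x ^ (P - 1) = 1"
  shows "\<exists>y. y ^ (P + 1) = x"
proof -
  obtain g :: 'a where g: "g \<noteq> 0" "\<And>x. x \<noteq> 0 \<Longrightarrow> \<exists>i. x = g ^ i"
    "\<And>i. g ^ i = 1 \<Longrightarrow> card (UNIV :: 'a set) - 1 dvd i"
    by (rule finite_field_generator) (rule that)
  have "x \<noteq> 0" using x P by (auto simp: power_0_left)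
  then obtain i where i: "x = g ^ i" using g(2) by blast
  have "P\<^sup>2 - 1 dvd i * (P - 1)"
    using dvd g(3)[of "i * (P - 1)"] x unfolding i by (auto simp: power_mult intro: dvd_trans)
  moreover have "P\<^sup>2 - 1 = (P + 1) * (P - 1)"
    by (simp add: power2_eq_square algebra_simps)
  ultimately have "(P + 1) * (P - 1) dvd i * (P - 1)" by (simp only:)
  then obtain r where "i * (P - 1) = (P + 1) * (P - 1) * r" by (rule dvdE)
  then have "i * (P - 1) = ((P + 1) * r) * (P - 1)" by (simp only: mult_ac)
  then have "i = (P + 1) * r" using P by auto
  then have "(g ^ r) ^ (P + 1) = x"
    unfolding i power_mult[symmetric] by (simp only: mult.commute)
  then show ?thesis by blast
qed

section \<open>Lagrange interpolation\<close>

text \<open>The interpolant \<open>L\<close> of \<open>h\<close> at the n nodes equals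
  \<open>h\<close>, since both have degree below n. Each \<open>q j\<close> is monic of degree n -
  1, so the weighted sum is the coefficient of \<open>L\<close> at n - 1.\<close>

lemma lagrange_top_coeff:
  fixes a :: "nat \<Rightarrow> 'a::field"
  assumes inj: "inj_on a {..<n}" and deg: "degree h < n"
  shows "(\<Sum>j<n. (\<Prod>i\<in>{..<n} - {j}. inverse (a j - a i)) * poly h (a j)) = Polynomial.coeff h (n - 1)"
proof -
  define u where "u j = (\<Prod>i\<in>{..<n} - {j}. inverse (a j - a i))" for j
  define q where "q j = (\<Prod>i\<in>{..<n} - {j}. [:- a i, 1:])" for j
  have q_deg: "degree (q j) = n - 1" if "j < n" for j
    unfolding q_def using that by (subst degree_prod_eq_sum_degree) auto
  have q_coeff: "Polynomial.coeff (q j) (n - 1) = 1" if "j < n" for j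
    using lead_coeff_prod[of "\<lambda>i. [:- a i, 1:]" "{..<n} - {j}"] q_deg[OF that] by (simp add: q_def)
  define L where "L = (\<Sum>j<n. Polynomial.smult (u j * poly h (a j)) (q j))"
  have q_other: "poly (q j) (a t) = 0" if "t < n" "t \<noteq> j" for j t
    unfolding q_def poly_prod using that by (intro prod_zero bexI[of _ t]) auto
  have q_self: "u j * poly (q j) (a j) = 1" if "j < n" for j
    unfolding q_def u_def poly_prod prod.distrib[symmetric] using that inj
    by (intro prod.neutral) (auto simp: inj_on_def intro!: left_inverse)
  have "poly L (a t) = poly h (a t)" if t: "t < n" for t
  proof -
    have "poly L (a t) = (\<Sum>j<n. if j = t then poly h (a t) else 0)"
      unfolding L_def poly_sum using t q_other q_self[OF t]
      by (intro sum.cong) (auto simp: mult_ac)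
    then show ?thesis using t by simp
  qed
  moreover have "degree L \<le> n - 1"
    unfolding L_def using q_deg
    by (intro degree_sum_le order.trans[OF degree_smult_le]) simp_all
  then have "degree L < n" using deg by linarith
  ultimately have L: "L = h"
    using deg inj by (intro poly_eqI_degree[of "a ` {..<n}"]) (auto simp: card_image)
  have "Polynomial.coeff L (n - 1) = (\<Sum>j<n. u j * poly h (a j) * Polynomial.coeff (q j) (n - 1))"
    unfolding L_def by (simp add: Polynomial.coeff_sum)
  also have "\<dots> = (\<Sum>j<n. u j * poly h (a j))" using q_coeff by (intro sum.cong) auto
  finally show ?thesis unfolding u_def L by simp
qed

section \<open>Codes that are linear images of polynomials with prescribed support\<close>

text \<open>Linearity is extended to sums one coordinate at a time: the sum on the right is then
  taken in the field and not among vectors, whose zero depends on the dimension.\<close>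

lemma index_linear_sum:
  fixes E :: "'a::field poly \<Rightarrow> 'a vec"
  assumes carr: "\<And>f. E f \<in> carrier_vec N"
    and add: "\<And>f g. E (f + g) = E f + E g"
    and smult: "\<And>c f. E (Polynomial.smult c f) = c \<cdot>\<^sub>v E f"
    and r: "r < N"
  shows "E (sum h J) $ r = (\<Sum>i\<in>J. E (h i) $ r)"
proof -
  have dimE [simp]: "dim_vec (E f) = N" for f
    using carr by (rule carrier_vecD)
  have "E 0 $ r = 0"
    using arg_cong[OF smult[of 0 0], of "\<lambda>w. w $ r"] r by simp
  then show ?thesis
    using r by (induction J rule: infinite_finite_induct) (simp_all add: add)
qed

text \<open>The images of the monomials with exponent in \<open>I\<close> form a basis, because
  \<open>E\<close> has trivial kernel on polynomials supported in \<open>I\<close>. It yields the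
  dimension of the code, with \<open>I\<close> all exponents below k, and that of its hull, with a
  smaller \<open>I\<close>.\<close>

lemma linear_code_supported_image:
  fixes E :: "'a::field poly \<Rightarrow> 'a vec"
  assumes carr: "\<And>f. E f \<in> carrier_vec N"
    and add: "\<And>f g. E (f + g) = E f + E g"
    and smult: "\<And>c f. E (Polynomial.smult c f) = c \<cdot>\<^sub>v E f"
    and I: "finite I"
    and ker: "\<And>f. (\<forall>i. i \<notin> I \<longrightarrow> Polynomial.coeff f i = 0) \<Longrightarrow> E f = 0\<^sub>v N \<Longrightarrow> f = 0"
  shows "linear_code N (card I) {E f | f. \<forall>i. i \<notin> I \<longrightarrow> Polynomial.coeff f i = 0}"
proof -
  interpret vec_space "TYPE('a)" N .
  define W where "W = {E f | f. \<forall>i. i \<notin> I \<longrightarrow> Polynomial.coeff f i = 0}"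
  define b where "b i = E (Polynomial.monom 1 i)" for i
  have dimE [simp]: "dim_vec (E f) = N" for f
    using carr by (rule carrier_vecD)
  have zero: "E 0 = 0\<^sub>v N"
    using smult[of 0 0] carr[of 0] by simp
  have W_add: "v + w \<in> W" if "v \<in> W" "w \<in> W" for v w
  proof -
    from that obtain f g where "v = E f" "w = E g"
      "\<forall>i. i \<notin> I \<longrightarrow> Polynomial.coeff f i = 0" "\<forall>i. i \<notin> I \<longrightarrow> Polynomial.coeff g i = 0"
      unfolding W_def by auto
    then show ?thesis unfolding W_def by (auto intro!: exI[of _ "f + g"] simp: add)
  qed
  have W_smult: "c \<cdot>\<^sub>v v \<in> W" if "v \<in> W" for c v
  proof -
    from that obtain f where "v = E f" "\<forall>i. i \<notin> I \<longrightarrow> Polynomial.coeff f i = 0"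
      unfolding W_def by auto
    then show ?thesis unfolding W_def by (auto intro!: exI[of _ "Polynomial.smult c f"] simp: smult)
  qed
  have W_zero: "0\<^sub>v N \<in> W" unfolding W_def using zero by (auto intro!: exI[of _ 0])
  have W_sub: "W \<subseteq> carrier_vec N" unfolding W_def using carr by auto
  have submod: "submodule class_ring W V"
    by (unfold_locales) (use W_add W_smult W_zero W_sub in \<open>auto simp: module_vec_simps\<close>)
  have sub: "VectorSpace.subspace class_ring W V"
    using submod vec_vs unfolding VectorSpace.subspace_def by auto
  interpret W: vectorspace class_ring "vs W"
    by (rule subspace_is_vs[OF sub])
  have inj: "inj_on b I"
  proof (rule inj_onI)
    fix i j assume ij: "i \<in> I" "j \<in> I" "b i = b j"
    \<comment> \<open>The difference is written with the scalar -1, because \<open>E\<close> is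
      known to respect only sums and scalar multiples.\<close>
    have "E (Polynomial.monom 1 i + Polynomial.smult (-1) (Polynomial.monom 1 j)) = 0\<^sub>v N"
      unfolding add smult using ij(3) carr[of "Polynomial.monom 1 j"] unfolding b_def by auto
    then have "Polynomial.monom 1 i + Polynomial.smult (-1) (Polynomial.monom 1 j) = (0 :: 'a poly)"
      by (intro ker) (use ij in auto)
    then have "Polynomial.monom 1 i = (Polynomial.monom 1 j :: 'a poly)" by simp
    then show "i = j" by (metis degree_monom_eq zero_neq_one)
  qed
  have BC: "b ` I \<subseteq> carrier_vec N" unfolding b_def using carr by auto
  have BW: "b ` I \<subseteq> W" unfolding b_def W_def by fastforce
  have lc: "lincomb c (b ` I) = E (\<Sum>i\<in>I. Polynomial.smult (c (b i)) (Polynomial.monom 1 i))" for c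
  proof (rule eq_vecI)
    have d: "dim_vec (lincomb c (b ` I)) = N" using lincomb_dim[OF _ BC] I by simp
    show "dim_vec (lincomb c (b ` I)) = dim_vec (E (\<Sum>i\<in>I. Polynomial.smult (c (b i)) (Polynomial.monom 1 i)))"
      using d by simp
    fix r assume "r < dim_vec (E (\<Sum>i\<in>I. Polynomial.smult (c (b i)) (Polynomial.monom 1 i)))"
    then have r: "r < N" by simp
    show "lincomb c (b ` I) $ r = E (\<Sum>i\<in>I. Polynomial.smult (c (b i)) (Polynomial.monom 1 i)) $ r"
      unfolding lincomb_index[OF r BC] index_linear_sum[OF carr add smult r] sum.reindex[OF inj]
      using r by (simp add: smult b_def del: smult_monom)
  qed
  have co: "Polynomial.coeff (\<Sum>i\<in>I. Polynomial.smult (c i) (Polynomial.monom 1 i)) j = (if j \<in> I then c j else 0)"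
    for c :: "nat \<Rightarrow> 'a" and j
    using I by (simp add: Polynomial.coeff_sum if_distrib sum.delta cong: if_cong)
  have li: "lin_indpt (b ` I)"
  proof (rule finite_lin_indpt2)
    show "finite (b ` I)" using I by simp
    show "b ` I \<subseteq> carrier_vec N" by (rule BC)
    fix c assume "lincomb c (b ` I) = 0\<^sub>v N"
    then have "(\<Sum>i\<in>I. Polynomial.smult (c (b i)) (Polynomial.monom 1 i)) = 0"
      unfolding lc by (intro ker) (auto simp: co simp del: smult_monom)
    then have "c (b i) = 0" if "i \<in> I" for i using co[of "\<lambda>i. c (b i)" i] that by simp
    then show "\<forall>v\<in>b ` I. c v = 0" by auto
  qed
  have gen: "span (b ` I) = W"
  proof
    show "span (b ` I) \<subseteq> W" by (rule span_is_subset[OF BW submod])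
    show "W \<subseteq> span (b ` I)"
    proof
      fix w assume "w \<in> W"
      then obtain f where f: "w = E f" "\<forall>i. i \<notin> I \<longrightarrow> Polynomial.coeff f i = 0" unfolding W_def by auto
      \<comment> \<open>\<open>lincomb\<close> takes its coefficients as a function of the basis
        vectors, so those of \<open>f\<close> are transported along the inverse of
        \<open>b\<close>.\<close>
      define c where "c v = Polynomial.coeff f (inv_into I b v)" for v
      have "f = (\<Sum>i\<in>I. Polynomial.smult (c (b i)) (Polynomial.monom 1 i))"
        by (rule poly_eqI, unfold co, insert f(2) inj, auto simp: c_def)
      then have "w = lincomb c (b ` I)" unfolding lc f(1) by simp
      then show "w \<in> span (b ` I)" unfolding span_def using I by blast
    qed
  qed
  have "W.basis (b ` I)"
    unfolding W.basis_def using span_li_not_depend[OF BW submod] li gen BW by simp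
  then have "W.dim = card (b ` I)" using I by (intro W.dim_basis) auto
  then show ?thesis
    unfolding linear_code_def code_dim_def W_def[symmetric] using sub card_image[OF inj] by simp
qed

section \<open>Codewords of generalized Roth-Lempel codes\<close>

text \<open>The element of \<open>GRL\<close> belonging to one polynomial, as a function of that
  polynomial, so that its linearity can be stated.\<close>

definition grl_word :: "nat \<Rightarrow> 'a::field vec \<Rightarrow> 'a vec \<Rightarrow> 'a mat \<Rightarrow> 'a poly \<Rightarrow> 'a vec" where
  "grl_word k a v A f =
     vec (dim_vec a) (\<lambda>i. v $ i * poly f (a $ i)) @\<^sub>v
     (transpose_mat A *\<^sub>v vec (dim_row A) (\<lambda>i. Polynomial.coeff f (k - dim_row A + i)))"

context
  fixes n s k :: nat and a v :: "'a::field vec" and A :: "'a mat"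
  assumes a: "a \<in> carrier_vec n" and A: "A \<in> carrier_mat s s"
begin

lemma grl_word_carrier: "grl_word k a v A f \<in> carrier_vec (n + s)"
  using a A by (auto simp: grl_word_def)

lemma grl_word_index_left: "r < n \<Longrightarrow> grl_word k a v A f $ r = v $ r * poly f (a $ r)"
  using a A by (simp add: grl_word_def)

lemma grl_word_index_right:
  "c < s \<Longrightarrow> grl_word k a v A f $ (n + c) = (\<Sum>b<s. A $$ (b, c) * Polynomial.coeff f (k - s + b))"
  using a A by (auto simp: grl_word_def scalar_prod_def lessThan_atLeast0 intro!: sum.cong)

lemma grl_word_eqI:
  assumes "w \<in> carrier_vec (n + s)"
    and "\<And>r. r < n \<Longrightarrow> grl_word k a v A f $ r = w $ r"
    and "\<And>c. c < s \<Longrightarrow> grl_word k a v A f $ (n + c) = w $ (n + c)"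
  shows "grl_word k a v A f = w"
proof (rule eq_vecI)
  show "dim_vec (grl_word k a v A f) = dim_vec w"
    using assms(1) grl_word_carrier[of f] by simp
  fix r assume "r < dim_vec w"
  then have r: "r < n + s" using assms(1) by simp
  then show "grl_word k a v A f $ r = w $ r"
    using assms(2)[of r] assms(3)[of "r - n"] by (cases "r < n") auto
qed

lemma grl_word_add: "grl_word k a v A (f + g) = grl_word k a v A f + grl_word k a v A g"
  using grl_word_carrier[of f] grl_word_carrier[of g]
  by (intro grl_word_eqI)
    (auto simp: grl_word_index_left grl_word_index_right distrib_left sum.distrib)

lemma grl_word_smult: "grl_word k a v A (Polynomial.smult c f) = c \<cdot>\<^sub>v grl_word k a v A f"
  using grl_word_carrier[of f]
  by (intro grl_word_eqI)
    (auto simp: grl_word_index_left grl_word_index_right mult.left_commute sum_distrib_left)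

text \<open>The first n coordinates already determine \<open>f\<close>: as no entry of
  \<open>v\<close> is zero, a zero codeword makes the n distinct entries of \<open>a\<close> roots
  of a polynomial of degree below n.\<close>

lemma linear_code_grl_words:
  assumes inj: "inj_on (($) a) {..<n}" and v: "\<And>i. i < n \<Longrightarrow> v $ i \<noteq> 0"
    and I: "I \<subseteq> {..<n}"
  shows "linear_code (n + s) (card I)
    {grl_word k a v A f | f. \<forall>i. i \<notin> I \<longrightarrow> Polynomial.coeff f i = 0}"
proof (rule linear_code_supported_image)
  show "finite I" using I finite_subset by blast
  fix f assume supp: "\<forall>i. i \<notin> I \<longrightarrow> Polynomial.coeff f i = 0"
    and zero: "grl_word k a v A f = 0\<^sub>v (n + s)"
  show "f = 0"
  proof (rule ccontr)
    assume f: "f \<noteq> 0"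
    then have "degree f < n" using supp I leading_coeff_neq_0 by blast
    moreover have root: "poly f (a $ r) = 0" if "r < n" for r
      using zero grl_word_index_left[OF that, of f] v[OF that] that by simp
    have "n \<le> card {x. poly f x = 0}"
      using card_mono[OF poly_roots_finite[OF f], of "($) a ` {..<n}"] root card_image[OF inj] by auto
    ultimately show False using card_poly_roots_bound[OF f] by simp
  qed
qed (fact grl_word_carrier grl_word_add grl_word_smult)+

text \<open>The Galois inner product is linear in its first argument, so orthogonality to the whole
  code can be tested on the codewords of monomials.\<close>

lemma galois_inner_grl_word:
  assumes "degree f < k"
  shows "galois_inner p l (grl_word k a v A f) y =
    (\<Sum>i<k. Polynomial.coeff f i * galois_inner p l (grl_word k a v A (Polynomial.monom 1 i)) y)"
proof -
  let ?E = "grl_word k a v A"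
  have dim [simp]: "dim_vec (?E g) = n + s" for g using grl_word_carrier[of g] by simp
  have f: "f = (\<Sum>i<k. Polynomial.smult (Polynomial.coeff f i) (Polynomial.monom 1 i))"
    by (rule poly_eqI) (use assms in \<open>auto simp: Polynomial.coeff_sum if_distrib coeff_eq_0 cong: if_cong\<close>)
  have ind: "?E f $ r = (\<Sum>i<k. Polynomial.coeff f i * ?E (Polynomial.monom 1 i) $ r)" if "r < n + s" for r
    by (subst f, subst index_linear_sum[OF grl_word_carrier grl_word_add grl_word_smult that])
      (use that in \<open>simp add: grl_word_smult del: smult_monom\<close>)
  have "galois_inner p l (?E f) y =
      (\<Sum>r<n + s. \<Sum>i<k. Polynomial.coeff f i * (?E (Polynomial.monom 1 i) $ r * (y $ r) ^ p ^ l))"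
    by (simp add: galois_inner_def ind sum_distrib_right mult.assoc)
  then show ?thesis
    by (subst (asm) sum.swap) (simp add: galois_inner_def sum_distrib_left)
qed

end

section \<open>The kernel of the Gram matrix\<close>

text \<open>Here G is the contribution of the evaluation coordinates to the Gram matrix of the monomials,
  \<beta> is the exceptional column of A, and M i is the product of the codewords of x ^ i and of
  the polynomial with coefficients g.\<close>

lemma twisted_gram_kernel:
  fixes G :: "nat \<Rightarrow> nat \<Rightarrow> 'a::field" and g \<beta> :: "nat \<Rightarrow> 'a"
  assumes G0: "\<And>i j. i + P * j < m * (P + 1) \<Longrightarrow> G i j = 0"
    and G1: "\<And>i j. i + P * j = m * (P + 1) \<Longrightarrow> G i j = lam"
    and lam: "lam \<noteq> 0" and alpha: "\<alpha> ^ (P + 1) = - lam"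
    and beta: "\<And>j. \<beta> j = - G j m / \<alpha> ^ P"
    and k: "k = \<xi> + 1 + m" and xi: "\<xi> < P" "P * \<xi> \<le> m"
    and s: "\<xi> < s" "s \<le> \<xi> + P" "s < k"
  defines "M \<equiv> \<lambda>i. (\<Sum>j<k. g j ^ P * G i j) + (if k - s \<le> i \<and> i \<noteq> m then g i ^ P else 0) +
      \<beta> i * (\<Sum>j<k. \<beta> j * g j) ^ P"
  shows "(\<forall>i<k. M i = 0) \<longleftrightarrow> (\<forall>j<k. k - s \<le> j \<and> j \<noteq> m \<longrightarrow> g j = 0)"
proof -
  have alpha0: "\<alpha> \<noteq> 0" using alpha lam by auto
  have P: "P > 0" using xi by simp
  have beta_low: "\<beta> j = 0" if "j < m" for j using G0[of j m] that by (simp add: beta)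
  \<comment> \<open>Here \<open>G m m = lam\<close>, and \<open>- lam / \<alpha> ^ P\<close> is
    \<open>\<alpha>\<close> by the choice of \<open>\<alpha>\<close>.\<close>
  have beta_m: "\<beta> m = \<alpha>"
    using G1[of m m] alpha alpha0 by (simp add: beta field_simps)
  \<comment> \<open>Without coefficients above m only column m survives in both sums: for j < m and
    i \<le> m + \<xi> one has i + P j \<le> m (P + 1) + \<xi> - P, where \<open>G\<close> vanishes
    because \<xi> < P. The two remaining terms are opposite by the definition of
    \<open>\<beta>\<close>.\<close>
  have cancel: "(\<Sum>j<k. g j ^ P * G i j) + \<beta> i * (\<Sum>j<k. \<beta> j * g j) ^ P = 0"
    if i: "i < k" and top: "\<And>j. m < j \<Longrightarrow> j < k \<Longrightarrow> g j = 0" for i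
  proof -
    have "G i j = 0" if "j < m" for j
    proof (rule G0)
      have "P * (j + 1) \<le> P * m" using that by (intro mult_le_mono2) simp
      then show "i + P * j < m * (P + 1)" using i k xi by (simp add: algebra_simps)
    qed
    then have "(\<Sum>j<k. g j ^ P * G i j) = (\<Sum>j<k. if j = m then g m ^ P * G i m else 0)"
      using top P by (intro sum.cong) (auto simp: linorder_neq_iff)
    moreover have "(\<Sum>j<k. \<beta> j * g j) = (\<Sum>j<k. if j = m then \<alpha> * g m else 0)"
      using top beta_low beta_m by (intro sum.cong) (auto simp: linorder_neq_iff)
    ultimately show ?thesis using k alpha0 by (simp add: beta power_mult_distrib)
  qed
  show ?thesis
  proof
    assume g: "\<forall>j<k. k - s \<le> j \<and> j \<noteq> m \<longrightarrow> g j = 0"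
    show "\<forall>i<k. M i = 0"
    proof (intro allI impI)
      fix i assume i: "i < k"
      have "g j = 0" if "m < j" "j < k" for j using g that k s by auto
      then show "M i = 0" unfolding M_def using cancel[OF i] g i P by (auto simp: algebra_simps)
    qed
  next
    assume M: "\<forall>i<k. M i = 0"
    \<comment> \<open>The coefficients above m are eliminated from the highest exponent m + \<xi>
      downwards.\<close>
    have top: "g (m + t) = 0" if "0 < t" "t \<le> \<xi>" for t
      using that
    proof (induction "\<xi> - t" arbitrary: t rule: less_induct)
      case less
      \<comment> \<open>Row i lies above the A-block, and in it the pivot \<lambda> of column m + t is the first
        nonzero entry.\<close>
      define i where "i = m - P * t"
      have Pt: "P \<le> P * t" "P * t \<le> P * \<xi>" using less.prems by auto
      \<comment> \<open>The subtraction is exact since P \<xi> \<le> m. From s \<le> \<xi> + P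
        follows k - s \<ge> m + 1 - P, which exceeds m - P t for every t \<ge> 1.\<close>
      have i: "i + P * t = m" "i < k - s" "i < m" "i < k"
        unfolding i_def using Pt xi P k s by linarith+
      have "g j ^ P * G i j = (if j = m + t then g (m + t) ^ P * lam else 0)" if j: "j < k" for j
      proof -
        consider "j < m + t" | "j = m + t" | "m + t < j" by linarith
        then show ?thesis
        proof cases
          case 1
          then have "P * j < P * (m + t)" using P by simp
          then have "G i j = 0" using i by (intro G0) (simp add: algebra_simps)
          then show ?thesis using 1 by simp
        next
          case 2
          then have "G i j = lam" using i by (intro G1) (simp add: algebra_simps)
          then show ?thesis using 2 by simp
        next
          case 3
          then have "g (m + (j - m)) = 0" using j k less.prems by (intro less.hyps) auto
          then show ?thesis using 3 P by simp
        qed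
      qed
      then have "(\<Sum>j<k. g j ^ P * G i j) = (\<Sum>j<k. if j = m + t then g (m + t) ^ P * lam else 0)"
        by (intro sum.cong) auto
      then have "M i = g (m + t) ^ P * lam"
        unfolding M_def using i k less.prems beta_low[of i] by simp
      then show ?case using M i lam by simp
    qed
    have top: "g j = 0" if "m < j" "j < k" for j using top[of "j - m"] that k by simp
    show "\<forall>j<k. k - s \<le> j \<and> j \<noteq> m \<longrightarrow> g j = 0"
    proof (intro allI impI)
      fix j assume j: "j < k" "k - s \<le> j \<and> j \<noteq> m"
      \<comment> \<open>By \<open>cancel\<close>, the Gram sum and the \<open>\<beta>\<close> term
        annihilate each other, and only the identity part of the matrix remains.\<close>
      have "M j = g j ^ P" unfolding M_def using cancel[OF j(1) top] j by (auto simp: algebra_simps)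
      then show "g j = 0" using M j by simp
    qed
  qed
qed

section \<open>The matrix A and the resulting inner products\<close>

definition hull_matrix :: "nat \<Rightarrow> nat \<Rightarrow> (nat \<Rightarrow> 'a::field) \<Rightarrow> 'a mat" where
  "hull_matrix s c w = mat s s (\<lambda>(i, j). if j = c then w i else if i = j then 1 else 0)"

lemma hull_matrix_carrier [simp]: "hull_matrix s c w \<in> carrier_mat s s"
  by (simp add: hull_matrix_def)

text \<open>As \<open>w\<close> vanishes above position \<open>c\<close>, the matrix is lower
  triangular, with diagonal entries 1 and \<open>w c\<close>.\<close>

lemma invertible_hull_matrix:
  assumes c: "c < s" and low: "\<And>i. i < c \<Longrightarrow> w i = 0" and w: "w c \<noteq> 0"
  shows "invertible_mat (hull_matrix s c w)"
proof -
  let ?A = "hull_matrix s c w"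
  have "det ?A = prod_list (diag_mat ?A)"
    by (rule det_lower_triangular[where n = s]) (auto simp: hull_matrix_def low)
  moreover have "0 \<notin> set (diag_mat ?A)"
    using w by (auto simp: diag_mat_def hull_matrix_def split: if_splits)
  ultimately have "det ?A \<noteq> 0" by (simp add: prod_list_zero_iff)
  then have "?A \<in> Units (ring_mat TYPE('a) s ())"
    by (rule det_non_zero_imp_unit[OF hull_matrix_carrier])
  then obtain B where "B \<in> carrier_mat s s" "B * ?A = 1\<^sub>m s" "?A * B = 1\<^sub>m s"
    by (auto simp: Units_def ring_mat_simps)
  then show ?thesis
    unfolding invertible_mat_def inverts_mat_def
    by (auto simp: hull_matrix_def intro!: exI[of _ B])
qed

text \<open>In the evaluation part, the \<open>p ^ l\<close>-th power is additive and splits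
  \<open>g\<close> into its monomials. In the last s coordinates, the codeword of \<open>g\<close>
  lists its top coefficients, except that the slot of x ^ m holds the
  \<open>\<beta>\<close>-weighted sum of all coefficients.\<close>

lemma galois_inner_grl_word_monom:
  fixes a v :: "'a::field vec" and \<beta> :: "nat \<Rightarrow> 'a"
  assumes p: "prime p" "CHAR('a) = p" and a: "a \<in> carrier_vec n"
    and m: "k - s \<le> m" "m < k" and s: "s \<le> k"
    and low: "\<And>j. j < m \<Longrightarrow> \<beta> j = 0"
    and g: "degree g < k" and i: "i < k"
  defines "A \<equiv> hull_matrix s (m - (k - s)) (\<lambda>b. \<beta> (k - s + b))"
  shows "galois_inner p l (grl_word k a v A (Polynomial.monom 1 i)) (grl_word k a v A g) =
    (\<Sum>j<k. Polynomial.coeff g j ^ p ^ l * (\<Sum>t<n. v $ t ^ (p ^ l + 1) * a $ t ^ (i + p ^ l * j))) +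
    (if k - s \<le> i \<and> i \<noteq> m then Polynomial.coeff g i ^ p ^ l else 0) +
    \<beta> i * (\<Sum>j<k. \<beta> j * Polynomial.coeff g j) ^ p ^ l"
proof -
  let ?P = "p ^ l" and ?E = "grl_word k a v A" and ?x = "Polynomial.monom 1 i :: 'a poly"
  let ?c = "m - (k - s)"
  define \<phi> where "\<phi> = (\<Sum>j<k. \<beta> j * Polynomial.coeff g j)"
  have A: "A \<in> carrier_mat s s" by (simp add: A_def)
  have c: "?c < s" using m s by auto
  have P: "?P > 0" using p(1) by (simp add: prime_gt_0_nat)
  have left: "?E ?x $ t * (?E g $ t) ^ ?P =
      (\<Sum>j<k. Polynomial.coeff g j ^ ?P * (v $ t ^ (?P + 1) * a $ t ^ (i + ?P * j)))" if t: "t < n" for t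
  proof -
    have "poly g (a $ t) = (\<Sum>j<k. Polynomial.coeff g j * a $ t ^ j)"
      unfolding poly_altdef using g by (intro sum.mono_neutral_left) (auto simp: coeff_eq_0)
    then have "poly g (a $ t) ^ ?P = (\<Sum>j<k. (Polynomial.coeff g j * a $ t ^ j) ^ ?P)"
      using freshmans_dream_sum'[where ?'a = 'a, of ?P l] p by simp
    then show ?thesis
      by (simp add: grl_word_index_left[OF a A t] poly_monom power_mult_distrib sum_distrib_left
        power_add power_mult[symmetric] mult_ac)
  qed
  have x_right: "?E ?x $ (n + b) = (if k - s \<le> i then A $$ (i - (k - s), b) else 0)" if b: "b < s" for b
  proof -
    have "?E ?x $ (n + b) = (\<Sum>d<s. if d = i - (k - s) \<and> k - s \<le> i then A $$ (i - (k - s), b) else 0)"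
      unfolding grl_word_index_right[OF a A b] by (intro sum.cong) auto
    then show ?thesis using i s by (auto simp: sum.delta)
  qed
  have g_right: "?E g $ (n + b) = (if b = ?c then \<phi> else Polynomial.coeff g (k - s + b))" if b: "b < s" for b
  proof (cases "b = ?c")
    case True
    have "(\<Sum>d<s. \<beta> (k - s + d) * Polynomial.coeff g (k - s + d)) =
        (\<Sum>j\<in>{k - s..<k}. \<beta> j * Polynomial.coeff g j)"
      by (rule sum.reindex_bij_witness[of _ "\<lambda>j. j - (k - s)" "\<lambda>d. k - s + d"]) (use s in auto)
    also have "\<dots> = \<phi>"
      \<comment> \<open>Extending the sum to exponents below k - s changes nothing, since these are
        below m, where \<open>\<beta>\<close> is zero.\<close>
      unfolding \<phi>_def using m by (intro sum.mono_neutral_left) (auto simp: low)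
    finally have "(\<Sum>d<s. A $$ (d, b) * Polynomial.coeff g (k - s + d)) = \<phi>"
      using True c by (simp add: A_def hull_matrix_def)
    then show ?thesis using True grl_word_index_right[OF a A b] by simp
  next
    case False
    have "?E g $ (n + b) = (\<Sum>d<s. if d = b then Polynomial.coeff g (k - s + b) else 0)"
      unfolding grl_word_index_right[OF a A b] using False b
      by (intro sum.cong) (auto simp: A_def hull_matrix_def)
    then show ?thesis using False b by simp
  qed
  have right: "(\<Sum>b<s. ?E ?x $ (n + b) * (?E g $ (n + b)) ^ ?P) =
      \<beta> i * \<phi> ^ ?P + (if k - s \<le> i \<and> i \<noteq> m then Polynomial.coeff g i ^ ?P else 0)"
  proof (cases "k - s \<le> i")
    case True
    then have r: "i - (k - s) < s" using i s by auto
    \<comment> \<open>Row i - (k - s) of \<open>A\<close> has at most two nonzero entries: the one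
      in the exceptional column and the diagonal one. For i = m they coincide and count
      once.\<close>
    have "?E ?x $ (n + b) * (?E g $ (n + b)) ^ ?P =
        (if b = ?c then \<beta> i * \<phi> ^ ?P else 0) +
        (if b = i - (k - s) then if i \<noteq> m then Polynomial.coeff g i ^ ?P else 0 else 0)"
      if b: "b < s" for b
      unfolding x_right[OF b] g_right[OF b] using True b r c m
      by (auto simp: A_def hull_matrix_def)
    then show ?thesis using True r c by (simp add: sum.distrib)
  next
    case False
    then have "\<beta> i = 0" using m by (intro low) auto
    then show ?thesis using False x_right by simp
  qed
  have "galois_inner p l (?E ?x) (?E g) = (\<Sum>r<n + s. ?E ?x $ r * (?E g $ r) ^ ?P)"
    using grl_word_carrier[OF a A, of k v ?x] by (simp add: galois_inner_def)
  also have "\<dots> = (\<Sum>r<n. ?E ?x $ r * (?E g $ r) ^ ?P) + (\<Sum>b<s. ?E ?x $ (n + b) * (?E g $ (n + b)) ^ ?P)"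
  proof -
    have split: "{..<n + s} = {..<n} \<union> {n..<n + s}" by auto
    have "(\<Sum>r\<in>{n..<n + s}. ?E ?x $ r * (?E g $ r) ^ ?P) =
        (\<Sum>b<s. ?E ?x $ (n + b) * (?E g $ (n + b)) ^ ?P)"
      by (rule sum.reindex_bij_witness[of _ "\<lambda>b. n + b" "\<lambda>r. r - n"]) auto
    then show ?thesis unfolding split by (subst sum.union_disjoint) auto
  qed
  also have "(\<Sum>r<n. ?E ?x $ r * (?E g $ r) ^ ?P) =
      (\<Sum>j<k. Polynomial.coeff g j ^ ?P * (\<Sum>t<n. v $ t ^ (?P + 1) * a $ t ^ (i + ?P * j)))"
  proof -
    have "(\<Sum>r<n. ?E ?x $ r * (?E g $ r) ^ ?P) =
        (\<Sum>t<n. \<Sum>j<k. Polynomial.coeff g j ^ ?P * (v $ t ^ (?P + 1) * a $ t ^ (i + ?P * j)))"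
      by (intro sum.cong refl left) simp
    also have "\<dots> = (\<Sum>j<k. \<Sum>t<n. Polynomial.coeff g j ^ ?P * (v $ t ^ (?P + 1) * a $ t ^ (i + ?P * j)))"
      by (rule sum.swap)
    finally show ?thesis by (simp only: sum_distrib_left)
  qed
  finally show ?thesis unfolding right \<phi>_def[symmetric] by (simp add: add_ac)
qed

section \<open>Construction of the code and computation of its hull\<close>

theorem mainTheorem5:
  fixes p e l n \<delta> k \<xi> s :: nat
    and a :: "'a::{field,finite} vec"
    and u :: "nat \<Rightarrow> 'a"
    and lam :: 'a
    and K :: "'a set"
  assumes "prime p"
    and "card (UNIV :: 'a set) = p ^ e"
    and "p ^ e > 4"
    and "l > 0"
    and "2 * l dvd e"
    and "subfield K class_ring"  (* K is the subfield of order p^l of F_q *)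
    and "card K = p ^ l"
    and "a \<in> carrier_vec n"
    and "inj_on (($) a) {..<n}"
    and "\<And>j. j < n \<Longrightarrow> u j = (\<Prod>i\<in>{..<n} - {j}. inverse (a $ j - a $ i))"
    and "\<delta> > 0"
    and "lam \<in> K - {0}"
    and "\<And>j. j < n \<Longrightarrow> lam * (a $ j) ^ (\<delta> - 1) * u j \<in> K - {0}"
    and "\<delta> < n"
    and "(p ^ l + 1) dvd (n - \<delta>)"
    and "k = \<xi> + 1 + (n - \<delta>) div (p ^ l + 1)"
    and "\<xi> \<le> min (p ^ l - 1) ((n - \<delta>) div (p ^ l * (p ^ l + 1)))"
    and "\<xi> + 1 \<le> s"
    and "s \<le> min (\<xi> + p ^ l) (k - 1)"
  shows "\<exists>C :: 'a vec set. is_GRL_code n s k C \<and> linear_code (n + s) k C \<and>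
           code_dim (n + s) (galois_hull p l (n + s) C) = k - s + 1"
proof -
  define P where "P = p ^ l"
  define m where "m = (n - \<delta>) div (P + 1)"
  have P: "P > 1" unfolding P_def using assms(1,4) prime_gt_1_nat one_less_power by blast
  have char: "CHAR('a) = p" by (rule CHAR_eq_of_card[OF assms(1,2)])
  have n: "n = \<delta> + m * (P + 1)"
  proof -
    have "m * (P + 1) = n - \<delta>" using assms(15) unfolding m_def P_def by (rule dvd_div_mult_self)
    then show ?thesis using assms(14) by linarith
  qed
  have k: "k = \<xi> + 1 + m" using assms(16) unfolding m_def P_def .
  have xi_P: "\<xi> < P" using assms(17) P unfolding P_def by linarith
  \<comment> \<open>Dividing n - \<delta> by P (P + 1) amounts to dividing by P + 1, which gives m,
    and then by P.\<close>
  have "\<xi> \<le> m div P"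
    using assms(17) unfolding m_def P_def div_mult2_eq[symmetric] by (simp add: mult.commute)
  then have xi_m: "P * \<xi> \<le> m"
    by (rule order_trans[OF mult_le_mono2 times_div_less_eq_dividend])
  have s: "\<xi> < s" "s \<le> \<xi> + P" "s < k" using assms(18,19) k unfolding P_def by auto
  \<comment> \<open>The chain \<xi> \<le> P \<xi> \<le> m \<le> m P gives k \<le> m P + m + 1, which
    is at most n because \<delta> \<ge> 1.\<close>
  have "\<xi> \<le> P * \<xi>" "m \<le> m * P" using P by simp_all
  moreover have "m * (P + 1) = m * P + m" by simp
  ultimately have kn: "k \<le> n" using k n assms(11) xi_m by linarith
  have K_ring: "subring K class_ring" by (rule subfieldE(1)[OF assms(6)])
  have K0: "0 \<in> K" using subringE(2)[OF K_ring] by simp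
  have K_neg: "- y \<in> K" if "y \<in> K" for y
    using subringE(5)[OF K_ring that] by (simp add: class_ring_simps)
  have K_mult: "y * z \<in> K" if "y \<in> K" "z \<in> K" for y z
    using subringE(6)[OF K_ring that] by simp
  have K_fin: "finite K" by simp
  \<comment> \<open>Since 2 l divides e, the field order is a power of
    \<open>P\<^sup>2\<close>.\<close>
  have "P\<^sup>2 - 1 dvd card (UNIV :: 'a set) - 1"
  proof -
    obtain c where "e = 2 * l * c" using assms(5) by blast
    then have "card (UNIV :: 'a set) = (P\<^sup>2) ^ c"
      unfolding assms(2) P_def by (simp add: power_mult[symmetric] mult_ac)
    then show ?thesis using nat_minus_one_dvd_power_minus_one[of "P\<^sup>2" c] P by simp
  qed
  then have norm: "\<exists>y. y ^ (P + 1) = x" if "x \<in> K - {0}" for x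
    using power_card_minus_one[OF K_fin K0 K_mult that] P that assms(7)
    by (intro norm_surjective) (auto simp: P_def)
  have "\<forall>j<n. \<exists>y. y ^ (P + 1) = lam * (a $ j) ^ (\<delta> - 1) * u j"
    using norm assms(13) by blast
  then obtain w where w: "\<And>j. j < n \<Longrightarrow> w j ^ (P + 1) = lam * (a $ j) ^ (\<delta> - 1) * u j" by metis
  define v where "v = vec n w"
  have v_carrier: "v \<in> carrier_vec n" by (simp add: v_def)
  have v_pow: "v $ j ^ (P + 1) = lam * (a $ j) ^ (\<delta> - 1) * u j" if "j < n" for j
    using w that by (simp add: v_def)
  have v_nz: "v $ j \<noteq> 0" if "j < n" for j
    using v_pow[OF that] assms(13)[OF that] by auto
  have "- lam \<in> K - {0}" using K_neg assms(12) by auto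
  then obtain \<alpha> where alpha: "\<alpha> ^ (P + 1) = - lam" using norm by blast
  have alpha0: "\<alpha> \<noteq> 0" using alpha assms(12) by auto
  define G where "G i j = (\<Sum>t<n. v $ t ^ (P + 1) * a $ t ^ (i + P * j))" for i j
  have G: "G i j = (if i + P * j = m * (P + 1) then lam else 0)" if "i + P * j \<le> m * (P + 1)" for i j
  proof -
    \<comment> \<open>The factor with exponent \<delta> - 1 in \<open>v_pow\<close> is absorbed into
      the monomial. As n - 1 = \<delta> - 1 + m (P + 1), its degree reaches n - 1 exactly when i + P
      j = m (P + 1).\<close>
    let ?h = "Polynomial.monom 1 (\<delta> - 1 + (i + P * j)) :: 'a poly"
    have deg: "degree ?h < n"
      using that n assms(11) unfolding degree_monom_eq[OF one_neq_zero] by linarith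
    have "v $ t ^ (P + 1) * a $ t ^ (i + P * j) = lam * (u t * poly ?h (a $ t))" if "t < n" for t
      unfolding v_pow[OF that] poly_monom power_add[of _ "\<delta> - 1"] by (simp only: mult_1 mult_ac)
    then have "G i j = (\<Sum>t<n. lam * (u t * poly ?h (a $ t)))"
      unfolding G_def by (intro sum.cong refl) simp
    also have "\<dots> = lam * (\<Sum>t<n. u t * poly ?h (a $ t))"
      by (rule sum_distrib_left[symmetric])
    also have "(\<Sum>t<n. u t * poly ?h (a $ t)) =
        (\<Sum>t<n. (\<Prod>r\<in>{..<n} - {t}. inverse (a $ t - a $ r)) * poly ?h (a $ t))"
      using assms(10) by (intro sum.cong refl arg_cong2[where f = "(*)"]) simp
    also have "\<dots> = Polynomial.coeff ?h (n - 1)"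
      by (rule lagrange_top_coeff[OF assms(9) deg])
    also have "\<dots> = (if i + P * j = m * (P + 1) then 1 else 0)"
      using n assms(11) by auto
    finally show ?thesis by simp
  qed
  have G_low: "G i j = 0" if "i + P * j < m * (P + 1)" for i j using G[of i j] that by simp
  have G_eq: "G i j = lam" if "i + P * j = m * (P + 1)" for i j using G[of i j] that by simp
  define \<beta> where "\<beta> j = - G j m / \<alpha> ^ P" for j
  have beta_low: "\<beta> j = 0" if "j < m" for j using G[of j m] that by (simp add: \<beta>_def)
  have beta_m: "\<beta> m \<noteq> 0" using G[of m m] alpha0 assms(12) by (simp add: \<beta>_def)
  \<comment> \<open>Rows and columns of \<open>A\<close> are numbered from the exponent k - s, hence
    the shift by k - s.\<close>
  define A where "A = hull_matrix s (m - (k - s)) (\<lambda>b. \<beta> (k - s + b))"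
  have A: "A \<in> carrier_mat s s" by (simp add: A_def)
  have m: "k - s \<le> m" "m < k" using s k by auto
  have A_inv: "invertible_mat A"
    unfolding A_def using m s beta_low beta_m by (intro invertible_hull_matrix) auto
  define E where "E = grl_word k a v A"
  define C where "C = GRL k a v A"
  have C: "C = {E f | f. degree f < k}" by (simp add: C_def GRL_def E_def grl_word_def)
  have deg_iff: "degree f < k \<longleftrightarrow> (\<forall>i. i \<notin> {..<k} \<longrightarrow> Polynomial.coeff f i = 0)" for f :: "'a poly"
    using m by (auto simp: coeff_eq_0)
  have lin: "linear_code (n + s) (card I) {E f | f. \<forall>i. i \<notin> I \<longrightarrow> Polynomial.coeff f i = 0}"
    if "I \<subseteq> {..<k}" for I
    unfolding E_def
  proof (rule linear_code_grl_words[OF assms(8) A assms(9) v_nz])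
    show "I \<subseteq> {..<n}" using that kn by force
  qed
  \<comment> \<open>The exponents allowed in the hull. Since m \<ge> k - s, the exponent m is a new
    one, which accounts for the + 1 in the dimension.\<close>
  define J where "J = {..<k - s} \<union> {m}"
  have J: "J \<subseteq> {..<k}" "card J = k - s + 1" unfolding J_def using m s by auto
  have ortho: "(\<forall>c\<in>C. galois_inner p l c (E g) = 0) \<longleftrightarrow> (\<forall>j<k. k - s \<le> j \<and> j \<noteq> m \<longrightarrow> Polynomial.coeff g j = 0)"
    if g: "degree g < k" for g
  proof -
    have "(\<forall>c\<in>C. galois_inner p l c (E g) = 0) \<longleftrightarrow>
        (\<forall>i<k. galois_inner p l (E (Polynomial.monom 1 i)) (E g) = 0)"
      (is "?L \<longleftrightarrow> ?R")
    proof
      assume ?L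
      moreover have "E (Polynomial.monom 1 i) \<in> C" if "i < k" for i
        unfolding C using that by (auto simp: degree_monom_eq intro!: exI[of _ "Polynomial.monom 1 i"])
      ultimately show ?R by blast
    next
      assume R: ?R
      show ?L
      proof
        fix c assume "c \<in> C"
        then obtain f where "c = E f" "degree f < k" unfolding C by blast
        then show "galois_inner p l c (E g) = 0"
          using galois_inner_grl_word[OF assms(8) A, of f k p l v "E g"] R by (simp add: E_def)
      qed
    qed
    also have "\<dots> \<longleftrightarrow> (\<forall>j<k. k - s \<le> j \<and> j \<noteq> m \<longrightarrow> Polynomial.coeff g j = 0)"
    proof -
      have inner: "galois_inner p l (E (Polynomial.monom 1 i)) (E g) =
          (\<Sum>j<k. Polynomial.coeff g j ^ P * G i j) +
          (if k - s \<le> i \<and> i \<noteq> m then Polynomial.coeff g i ^ P else 0) +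
          \<beta> i * (\<Sum>j<k. \<beta> j * Polynomial.coeff g j) ^ P" if "i < k" for i
        unfolding A_def E_def P_def G_def
        by (rule galois_inner_grl_word_monom[OF assms(1) char assms(8) m less_imp_le[OF s(3)] beta_low g that])
      have "lam \<noteq> 0" using assms(12) by simp
      from twisted_gram_kernel[where G = G and P = P and m = m, OF G_low G_eq this alpha \<beta>_def k xi_P xi_m s]
      show ?thesis by (subst all_cong[OF arg_cong[OF inner, of _ "\<lambda>x. x = 0"]]) simp_all
    qed
    finally show ?thesis .
  qed
  have "galois_hull p l (n + s) C = {E f | f. \<forall>i. i \<notin> J \<longrightarrow> Polynomial.coeff f i = 0}"
  proof -
    have "(degree f < k \<and> (\<forall>j<k. k - s \<le> j \<and> j \<noteq> m \<longrightarrow> Polynomial.coeff f j = 0)) \<longleftrightarrow>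
        (\<forall>i. i \<notin> J \<longrightarrow> Polynomial.coeff f i = 0)" for f :: "'a poly"
      unfolding deg_iff J_def using m by (auto simp: not_less) (metis le_less_trans not_less)
    moreover have "galois_hull p l (n + s) C =
        {E f | f. degree f < k \<and> (\<forall>j<k. k - s \<le> j \<and> j \<noteq> m \<longrightarrow> Polynomial.coeff f j = 0)}"
    proof -
      have "E f \<in> carrier_vec (n + s)" for f unfolding E_def by (rule grl_word_carrier[OF assms(8) A])
      then have "galois_hull p l (n + s) C = {c \<in> C. \<forall>b\<in>C. galois_inner p l b c = 0}"
        unfolding galois_hull_def galois_dual_def C by auto
      also have "\<dots> = {E f | f. degree f < k \<and> (\<forall>b\<in>C. galois_inner p l b (E f) = 0)}"
        unfolding C by blast
      also have "\<dots> = {E f | f. degree f < k \<and> (\<forall>j<k. k - s \<le> j \<and> j \<noteq> m \<longrightarrow> Polynomial.coeff f j = 0)}"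
        using ortho by blast
      finally show ?thesis .
    qed
    ultimately show ?thesis by simp
  qed
  then have "code_dim (n + s) (galois_hull p l (n + s) C) = k - s + 1"
    using lin[OF J(1)] J(2) by (simp add: linear_code_def)
  moreover have "linear_code (n + s) k C"
    using lin[OF order_refl] unfolding C deg_iff by simp
  moreover have "is_GRL_code n s k C"
    unfolding is_GRL_code_def C_def
    using s kn assms(8,9) v_carrier v_nz A A_inv by auto
  ultimately show ?thesis by blast
qed

end
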